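(* Let $V$ be a finite set, $\varepsilon>0$, $B$ a positive integer with $B\le|V|$, and let $F:2^V\to\mathbb{R}_{\ge0}$ be $\varepsilon$-approximately diminishing returns (case $k=1$). Let $X$ be the output of the greedy algorithm applied to $F$ with size bound $B$. Then $F(X)\ge(1-e^{-a})\max_{Y\subseteq V,|Y|\le B}F(Y)$, where $a=(1-\varepsilon)/(1+\varepsilon)$.
   Context: For $k=1$, $(k+1)^V$ is identified with $2^V$. $F$ is $\varepsilon$-approximately diminishing returns if there is a monotone submodular $f:2^V\to\mathbb{R}$ with $f(\emptyset)=0$ such that $(1-\varepsilon)(f(X\cup\{u\})-f(X))\le F(X\cup\{u\})-F(X)\le(1+\varepsilon)(f(X\cup\{u\})-f(X))$ for all $X\subseteq V$, $u\in V\setminus X$; also $F(\emptyset)=0$. The greedy algorithm starts from $X_0=\emptyset$ and for $j=1,\dots,B$ sets $X_j=X_{j-1}\cup\{e_j\}$ where $e_j\in\arg\max_{e\in V\setminus X_{j-1}}(F(X_{j-1}\cup\{e\})-F(X_{j-1}))$ (ties broken arbitrarily); it outputs $X=X_B$. *)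

theory Defs
  imports Complex_Main
begin

definition monotone_setfun :: "'a set \<Rightarrow> ('a set \<Rightarrow> real) \<Rightarrow> bool" where
  "monotone_setfun V f \<longleftrightarrow> (\<forall>X Y. X \<subseteq> Y \<longrightarrow> Y \<subseteq> V \<longrightarrow> f X \<le> f Y)"

definition submodular :: "'a set \<Rightarrow> ('a set \<Rightarrow> real) \<Rightarrow> bool" where
  "submodular V f \<longleftrightarrow>
     (\<forall>X Y. X \<subseteq> V \<longrightarrow> Y \<subseteq> V \<longrightarrow> f (X \<union> Y) + f (X \<inter> Y) \<le> f X + f Y)"

definition approx_diminishing_returns :: "'a set \<Rightarrow> real \<Rightarrow> ('a set \<Rightarrow> real) \<Rightarrow> bool" where
  "approx_diminishing_returns V \<epsilon> F \<longleftrightarrow>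
     F {} = 0 \<and>
     (\<exists>f. monotone_setfun V f \<and> submodular V f \<and> f {} = 0 \<and>
        (\<forall>X u. X \<subseteq> V \<longrightarrow> u \<in> V - X \<longrightarrow>
           (1 - \<epsilon>) * (f (X \<union> {u}) - f X) \<le> F (X \<union> {u}) - F X \<and>
           F (X \<union> {u}) - F X \<le> (1 + \<epsilon>) * (f (X \<union> {u}) - f X)))"

text \<open>\<open>greedy V F j X\<close> says that \<open>X\<close> is a possible state of the greedy algorithm
  after \<open>j\<close> steps; it is a relation because ties are broken arbitrarily.\<close>

inductive greedy :: "'a set \<Rightarrow> ('a set \<Rightarrow> real) \<Rightarrow> nat \<Rightarrow> 'a set \<Rightarrow> bool"
  for V :: "'a set" and F :: "'a set \<Rightarrow> real" where
  start: "greedy V F 0 {}"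
| step: "greedy V F j X \<Longrightarrow>
    is_arg_max (\<lambda>e. F (X \<union> {e}) - F X) (\<lambda>e. e \<in> V - X) e \<Longrightarrow>
    greedy V F (Suc j) (X \<union> {e})"

lemma greedy_subset_card:
  assumes "greedy V F j X"
  shows "X \<subseteq> V \<and> finite X \<and> card X = j"
  using assms by induction (auto simp: is_arg_max_def)

lemma greedy_exists:
  assumes "finite V" and "j \<le> card V"
  shows "\<exists>X. greedy V F j X"
  using assms(2)
proof (induction j)
  case 0
  show ?case using greedy.start by blast
next
  case (Suc j)
  then obtain X where X: "greedy V F j X" by auto
  have "V - X \<noteq> {}"
    using greedy_subset_card[OF X] Suc.prems by auto
  then obtain e where "is_arg_max (\<lambda>e. F (X \<union> {e}) - F X) (\<lambda>e. e \<in> V - X) e"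
    using ex_is_arg_min_if_finite[of "V - X" "\<lambda>e. - (F (X \<union> {e}) - F X)"] assms(1)
    by (auto simp: is_arg_min_def is_arg_max_def)
  then show ?case using greedy.step[OF X] by blast
qed

end

theory Submission
  imports Defs
begin

text \<open>Comparing \<open>F\<close> with \<open>f\<close> costs a factor \<open>1 + \<epsilon>\<close> in one direction and \<open>1 - \<epsilon>\<close> in the
  other, so in the classical argument for submodular functions the step bound becomes
  \<open>a * (F Y - F X) \<le> B * (F (X \<union> {e}) - F X)\<close> for the greedy choice \<open>e\<close>. Hence the gap to the
  optimum shrinks by a factor \<open>1 - a / B\<close> in each step, and \<open>(1 - a / B) ^ B \<le> exp (- a)\<close>. For
  \<open>\<epsilon> \<ge> 1\<close> the claimed factor is nonpositive.\<close>

text \<open>Insert the elements of \<open>Y\<close> one at a time: by diminishing returns each gains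
  at most what it would gain over \<open>X\<close> alone.\<close>

lemma submodular_union_le_sum_marginals:
  assumes "submodular V f" "finite Y" "X \<subseteq> V" "Y \<subseteq> V"
  shows "f (X \<union> Y) - f X \<le> (\<Sum>y\<in>Y. f (X \<union> {y}) - f X)"
  using assms(2,4)
proof (induction Y rule: finite_induct)
  case (insert y Y)
  \<comment> \<open>Since \<open>y\<close> is not in \<open>Y\<close>, these two sets meet exactly
    in \<open>X\<close>, so submodularity compares the marginal of \<open>y\<close> over
    \<open>X \<union> Y\<close> with that over \<open>X\<close>.\<close>
  have "f ((X \<union> Y) \<union> (X \<union> {y})) + f ((X \<union> Y) \<inter> (X \<union> {y})) \<le> f (X \<union> Y) + f (X \<union> {y})"
    using assms(1)[unfolded submodular_def, rule_format, of "X \<union> Y" "X \<union> {y}"]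
      assms(3) insert.prems by blast
  moreover have "(X \<union> Y) \<union> (X \<union> {y}) = X \<union> insert y Y" by auto
  moreover have "(X \<union> Y) \<inter> (X \<union> {y}) = X" using insert.hyps by auto
  ultimately show ?case using insert by simp
qed simp

text \<open>The one-element bounds telescope along an enumeration of \<open>Y\<close>. This
  transfers estimates between \<open>F\<close> and \<open>f\<close> for whole sets.\<close>

lemma union_increment_bounds:
  fixes f F :: "'a set \<Rightarrow> real"
  assumes marginal: "\<And>X u. X \<subseteq> V \<Longrightarrow> u \<in> V - X \<Longrightarrow>
      c * (f (X \<union> {u}) - f X) \<le> F (X \<union> {u}) - F X \<and>
      F (X \<union> {u}) - F X \<le> d * (f (X \<union> {u}) - f X)"
    and "finite Y" "X \<subseteq> V" "Y \<subseteq> V"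
  shows "c * (f (X \<union> Y) - f X) \<le> F (X \<union> Y) - F X \<and>
    F (X \<union> Y) - F X \<le> d * (f (X \<union> Y) - f X)"
  using assms(2,4)
proof (induction Y rule: finite_induct)
  case (insert y Y)
  show ?case
  proof (cases "y \<in> X")
    case True
    then have "X \<union> insert y Y = X \<union> Y" by auto
    then show ?thesis using insert by simp
  next
    case False
    then have "X \<union> Y \<subseteq> V" "y \<in> V - (X \<union> Y)"
      using insert.hyps insert.prems assms(3) by auto
    from marginal[OF this] show ?thesis
      using insert by (auto simp: algebra_simps)
  qed
qed simp

text \<open>Pass from \<open>F\<close> to \<open>f\<close> on \<open>X \<union> Y\<close>, split the
  \<open>f\<close>-increment into marginals over \<open>X\<close>, and return to \<open>F\<close>
  marginals, which the greedy choice dominates.\<close>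

lemma greedy_step_gain:
  assumes approx: "approx_diminishing_returns V \<epsilon> F" and "0 \<le> \<epsilon>" "\<epsilon> < 1"
    and "finite V" "X \<subseteq> V" "Y \<subseteq> V" "card Y \<le> B"
    and e: "is_arg_max (\<lambda>e. F (X \<union> {e}) - F X) (\<lambda>e. e \<in> V - X) e"
  shows "(1 - \<epsilon>) / (1 + \<epsilon>) * (F Y - F X) \<le> real B * (F (X \<union> {e}) - F X)"
proof -
  define g where "g = F (X \<union> {e}) - F X"
  obtain f where mono: "monotone_setfun V f" and sub: "submodular V f"
    and marginal: "\<And>X u. X \<subseteq> V \<Longrightarrow> u \<in> V - X \<Longrightarrow>
        (1 - \<epsilon>) * (f (X \<union> {u}) - f X) \<le> F (X \<union> {u}) - F X \<and>
        F (X \<union> {u}) - F X \<le> (1 + \<epsilon>) * (f (X \<union> {u}) - f X)"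
    using approx unfolding approx_diminishing_returns_def by blast
  have finY: "finite Y" using assms(4,6) finite_subset by blast
  have emax: "F (X \<union> {u}) - F X \<le> g" if "u \<in> V - X" for u
    using e that unfolding is_arg_max_linorder g_def by auto
  have eV: "e \<in> V - X" using e unfolding is_arg_max_def by blast
  have f_mono: "f Z \<le> f W" if "Z \<subseteq> W" "W \<subseteq> V" for Z W
    using mono that unfolding monotone_setfun_def by blast
  have "f X \<le> f (X \<union> {e})" using assms(5) eV by (intro f_mono) auto
  then have "0 \<le> (1 - \<epsilon>) * (f (X \<union> {e}) - f X)" using assms(3) by simp
  also have "\<dots> \<le> g" using marginal[OF assms(5) eV] unfolding g_def by blast
  finally have g0: "0 \<le> g" .
  \<comment> \<open>The greedy choice only competes with elements outside \<open>X\<close>; for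
    \<open>y\<close> in \<open>X\<close> the marginal is 0 and \<open>g0\<close> suffices.\<close>
  have single: "(1 - \<epsilon>) * (f (X \<union> {y}) - f X) \<le> g" if "y \<in> Y" for y
  proof (cases "y \<in> X")
    case True
    then show ?thesis using g0 by (simp add: insert_absorb)
  next
    case False
    then have "y \<in> V - X" using that assms(6) by blast
    then show ?thesis using marginal[OF assms(5)] emax by (meson order_trans)
  qed
  have increment: "(1 - \<epsilon>) * (f (Z \<union> W) - f Z) \<le> F (Z \<union> W) - F Z \<and>
      F (Z \<union> W) - F Z \<le> (1 + \<epsilon>) * (f (Z \<union> W) - f Z)" if "Z \<subseteq> V" "W \<subseteq> V" for Z W
    by (rule union_increment_bounds[where V = V])
      (use that assms(4) marginal in \<open>auto intro: finite_subset\<close>)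
  \<comment> \<open>Monotonicity of \<open>f\<close> carries over to \<open>F\<close>: adding
    \<open>X\<close> to \<open>Y\<close> cannot decrease \<open>F\<close>.\<close>
  have "f Y \<le> f (Y \<union> X)" using assms(5,6) by (intro f_mono) auto
  then have "0 \<le> (1 - \<epsilon>) * (f (Y \<union> X) - f Y)" using assms(3) by simp
  also have "\<dots> \<le> F (Y \<union> X) - F Y"
    using increment[OF assms(6,5)] by blast
  finally have "F Y - F X \<le> F (X \<union> Y) - F X" by (simp add: Un_commute)
  also have "\<dots> \<le> (1 + \<epsilon>) * (f (X \<union> Y) - f X)"
    using increment[OF assms(5,6)] by blast
  \<comment> \<open>The extra factor \<open>1 - \<epsilon>\<close> is distributed over the marginals
    below, where \<open>single\<close> absorbs it.\<close>
  finally have "(1 - \<epsilon>) * (F Y - F X) \<le> (1 - \<epsilon>) * ((1 + \<epsilon>) * (f (X \<union> Y) - f X))"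
    using assms(3) by (intro mult_left_mono) auto
  also have "\<dots> = (1 + \<epsilon>) * ((1 - \<epsilon>) * (f (X \<union> Y) - f X))" by simp
  also have "\<dots> \<le> (1 + \<epsilon>) * ((1 - \<epsilon>) * (\<Sum>y\<in>Y. f (X \<union> {y}) - f X))"
    using submodular_union_le_sum_marginals[OF sub finY assms(5,6)] assms(2,3)
    by (intro mult_left_mono) auto
  also have "\<dots> = (1 + \<epsilon>) * (\<Sum>y\<in>Y. (1 - \<epsilon>) * (f (X \<union> {y}) - f X))"
    by (simp add: sum_distrib_left)
  also have "\<dots> \<le> (1 + \<epsilon>) * (real (card Y) * g)"
    using assms(2) sum_bounded_above[of Y, OF single] by (intro mult_left_mono) auto
  \<comment> \<open>\<open>Y\<close> may have fewer than \<open>B\<close> elements;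
    \<open>g0\<close> allows the larger count.\<close>
  also have "\<dots> \<le> (1 + \<epsilon>) * (real B * g)"
    using assms(2,7) g0 by (intro mult_left_mono mult_right_mono) auto
  finally show ?thesis
    using assms(2) unfolding g_def by (simp add: field_simps)
qed

lemma greedy_gap:
  assumes approx: "approx_diminishing_returns V \<epsilon> F" and "0 \<le> \<epsilon>" "\<epsilon> < 1"
    and "finite V" "Y \<subseteq> V" "card Y \<le> B" "B > 0"
    and "greedy V F j X"
  shows "F Y - F X \<le> (1 - (1 - \<epsilon>) / (1 + \<epsilon>) / real B) ^ j * F Y"
  using assms(8)
proof induction
  case start
  show ?case using approx unfolding approx_diminishing_returns_def by simp
next
  case (step j X e)
  define a where "a = (1 - \<epsilon>) / (1 + \<epsilon>)"
  \<comment> \<open>With \<open>B \<ge> 1\<close> this makes the contraction factor nonnegative, so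
    the induction hypothesis can be multiplied by it.\<close>
  have "a \<le> 1" unfolding a_def using assms(2) by simp
  then have q: "0 \<le> 1 - a / real B" using assms(7) by (simp add: field_simps)
  have "a * (F Y - F X) \<le> real B * (F (X \<union> {e}) - F X)"
    unfolding a_def
    using greedy_step_gain[OF assms(1-4) _ assms(5,6) step.hyps(2)]
      greedy_subset_card[OF step.hyps(1)] by blast
  then have "F Y - F (X \<union> {e}) \<le> (1 - a / real B) * (F Y - F X)"
    using assms(7) by (simp add: field_simps)
  also have "\<dots> \<le> (1 - a / real B) * ((1 - a / real B) ^ j * F Y)"
    using step.IH q unfolding a_def by (rule mult_left_mono)
  finally show ?case unfolding a_def by (simp add: mult.assoc)
qed

theorem theorem3:
  fixes V :: "'a set" and F :: "'a set \<Rightarrow> real" and \<epsilon> :: real and B :: nat and X :: "'a set"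
  assumes "finite V"
    and "\<epsilon> > 0"
    and "B > 0" and "B \<le> card V"
    and "\<And>Y. Y \<subseteq> V \<Longrightarrow> F Y \<ge> 0"
    and "approx_diminishing_returns V \<epsilon> F"
    and "greedy V F B X"
  shows "F X \<ge> (1 - exp (- ((1 - \<epsilon>) / (1 + \<epsilon>)))) * Max (F ` {Y. Y \<subseteq> V \<and> card Y \<le> B})"
proof -
  define a where "a = (1 - \<epsilon>) / (1 + \<epsilon>)"
  have "finite (F ` {Y. Y \<subseteq> V \<and> card Y \<le> B})" using assms(1) by simp
  moreover have "F ` {Y. Y \<subseteq> V \<and> card Y \<le> B} \<noteq> {}" by (auto intro!: exI[of _ "{}"])
  ultimately have "Max (F ` {Y. Y \<subseteq> V \<and> card Y \<le> B}) \<in> F ` {Y. Y \<subseteq> V \<and> card Y \<le> B}"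
    by (rule Max_in)
  then obtain Y where Y: "Y \<subseteq> V" "card Y \<le> B"
    and opt: "Max (F ` {Y. Y \<subseteq> V \<and> card Y \<le> B}) = F Y" by auto
  have "(1 - exp (- a)) * F Y \<le> F X"
  proof (cases "\<epsilon> < 1")
    case True
    have "a \<le> 1" using assms(2) unfolding a_def by simp
    \<comment> \<open>This is the range in which \<open>(1 - a / B) ^ B\<close> is bounded by
      \<open>exp (- a)\<close>.\<close>
    then have "a \<le> real B" using assms(3) by simp
    then have "(1 - a / real B) ^ B \<le> exp (- a)"
      using exp_ge_one_minus_x_over_n_power_n[of a B] assms(3) by blast
    then have "(1 - a / real B) ^ B * F Y \<le> exp (- a) * F Y"
      using assms(5)[OF Y(1)] by (rule mult_right_mono)
    moreover have "F Y - F X \<le> (1 - a / real B) ^ B * F Y"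
      unfolding a_def using assms(2) True
      by (intro greedy_gap[OF assms(6) _ _ assms(1) Y assms(3,7)]) auto
    ultimately show ?thesis by (simp add: algebra_simps)
  next
    case False
    \<comment> \<open>Here \<open>a \<le> 0\<close>, and nonnegativity of \<open>F\<close> at
      \<open>Y\<close> and at \<open>X\<close> puts 0 between the two sides.\<close>
    then have "1 - exp (- a) \<le> 0"
      using assms(2) unfolding a_def by (simp add: divide_le_0_iff)
    then have "(1 - exp (- a)) * F Y \<le> 0"
      using assms(5)[OF Y(1)] by (rule mult_nonpos_nonneg)
    also have "0 \<le> F X" using assms(5)[of X] greedy_subset_card[OF assms(7)] by simp
    finally show ?thesis .
  qed
  then show ?thesis unfolding opt a_def .
qed

end
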